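(* Let $X,U$ be real Banach spaces, with $X$ an ordered Banach space with positive cone $X_+$, let $X_t\subset X$, $U_t\subset U$, $f_t:X_t\times U_t\to X_{t+1}$, $\phi_t:X_t\times U_t\to\mathbb{R}$ ($t\in\mathbb{N}$), and let $\sigma\in X_0$. Let $k\in\{1,2,3\}$ and let $((\hat x_t)_{t\in\mathbb{N}},(\hat u_t)_{t\in\mathbb{N}})$ be an optimal process (solution) of the problem $(\mathbf{PI}_k(\sigma))$. Assume: (A1) for all $t\in\mathbb{N}$, $X_t$ is a nonempty open subset of $X$ and $U_t$ is a nonempty subset of $U$; (A2) $X$ is separable; (A3) for all $t\in\mathbb{N}$, $\phi_t$ is Fréchet differentiable at $(\hat x_t,\hat u_t)$ and $f_t$ is continuously Fréchet differentiable at $(\hat x_t,\hat u_t)$; (A4) for all $t\in\mathbb{N}_*$, $0\in \mathrm{Int}\left[Df_t(\hat x_t,\hat u_t)\big((X\times T_{U_t}(\hat u_t))\cap B_{X\times U}\big)\right]$; (A5) for all $t\in\mathbb{N}$, the range of $D_2f_t(\hat x_t,\hat u_t)$ is closed and has finite codimension in $X$; (A6) $s\in\mathbb{N}$ is such that $A_s:=D_2f_s(\hat x_s,\hat u_s)(T_{U_s}(\hat u_s))$ contains a closed convex subset $K$ with $\mathrm{ri}(K)\neq\emptyset$ and such that $\overline{\mathrm{Aff}(K)}$ is of finite codimension in $X$. Assume moreover that $U_t$ is convex for all $t\in\mathbb{N}$ and that $\mathrm{Int}(X_+)\neq\emptyset$. Then there exist $\lambda_0\in\mathbb{R}$ and $(p_t)_{t\ge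 1}\in (X^* )^{\mathbb{N}_*}$ such that: (1) $(\lambda_0,p_t)\neq(0,0)$ for all $t\in\mathbb{N}_*$ with $t\ge s$; (2) $\lambda_0\ge 0$, and $p_n\ge 0$ for all $n\in\mathbb{N}_*$; (3) $p_t=p_{t+1}\circ D_1f_t(\hat x_t,\hat u_t)+\lambda_0 D_1\phi_t(\hat x_t,\hat u_t)$ for all $t\in\mathbb{N}_*$; (4) $\langle \lambda_0 D_2\phi_t(\hat x_t,\hat u_t)+p_{t+1}\circ D_2f_t(\hat x_t,\hat u_t),\,u_t-\hat u_t\rangle\le 0$ for all $t\in\mathbb{N}$ and all $u_t\in U_t$.
   Context: $\mathbb{N}=\{0,1,2,\dots\}$, $\mathbb{N}_*=\mathbb{N}\setminus\{0\}$; $X^*$ is the topological dual of $X$. The positive cone $X_+=\{x\in X:x\ge 0\}$ is a closed convex cone with $X_+\cap(-X_+)=\{0\}$, and $x\le y$ means $y-x\in X_+$. For $p\in X^*$, $p\ge 0$ means $p(x)\ge 0$ for all $x\in X_+$. $\mathrm{Iad}(\sigma)$ is the set of processes $((x_t)_{t\in\mathbb{N}},(u_t)_{t\in\mathbb{N}})\in\prod_{t}X_t\times\prod_t U_t$ with $x_0=\sigma$ and $x_{t+1}\le f_t(x_t,u_t)$ for all $t\in\mathbb{N}$. $\mathrm{Idom}(\sigma)$ is the set of those processes in $\mathrm{Iad}(\sigma)$ for which the series $\sum_{t=0}^{+\infty}\phi_t(x_t,u_t)$ converges in $\mathbb{R}$; on it $J((x_t)_t,(u_t)_t):=\sum_{t=0}^{+\infty}\phi_t(x_t,u_t)$.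 $(\mathbf{PI}_1(\sigma))$: find $((\hat x_t),(\hat u_t))\in\mathrm{Idom}(\sigma)$ such that $J((\hat x_t),(\hat u_t))\ge J((x_t),(u_t))$ for all $((x_t),(u_t))\in\mathrm{Idom}(\sigma)$. $(\mathbf{PI}_2(\sigma))$: find $((\hat x_t),(\hat u_t))\in\mathrm{Iad}(\sigma)$ such that $\limsup_{T\to+\infty}\sum_{t=0}^T(\phi_t(\hat x_t,\hat u_t)-\phi_t(x_t,u_t))\ge 0$ for all $((x_t),(u_t))\in\mathrm{Iad}(\sigma)$. $(\mathbf{PI}_3(\sigma))$: the same as $(\mathbf{PI}_2(\sigma))$ with $\liminf$ in place of $\limsup$. $T_{U_t}(\hat u_t):=\overline{\{\alpha(u_t-\hat u_t):\alpha\in[0,+\infty),\,u_t\in U_t\}}$. $B_{X\times U}$ is the closed unit ball of $X\times U$. $\mathrm{Int}$ is the topological interior. $\mathrm{Aff}(K)$ is the affine hull of $K$ and $\mathrm{ri}(K)$ is the interior of $K$ in the topological subspace $\mathrm{Aff}(K)$. $D_1,D_2$ denote the partial Fréchet differentials with respect to the first (state) and second (control) variable. Since $U_t$ need not be open, differentiability of a mapping $f$ on $X_t\times U_t$ at $(\hat x_t,\hat u_t)$ means that there is a differentiable function $\tilde f$ defined on an open neighborhood of $(\hat x_t,\hat u_t)$ which equals $f$ on the intersection of this neighborhood with $X_t\times U_t$ (and the differentials are those of $\tilde f$). *)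

theory Defs
  imports "HOL-Analysis.Analysis"
begin

definition admissible ::
  "(nat \<Rightarrow> 'x set) \<Rightarrow> (nat \<Rightarrow> 'u set) \<Rightarrow> (nat \<Rightarrow> 'x \<times> 'u \<Rightarrow> 'x::ord) \<Rightarrow> 'x
    \<Rightarrow> ((nat \<Rightarrow> 'x) \<times> (nat \<Rightarrow> 'u)) set"
  where "admissible X U f \<sigma> =
    {(x, u). (\<forall>t. x t \<in> X t) \<and> (\<forall>t. u t \<in> U t) \<and> x 0 = \<sigma> \<and> (\<forall>t. x (Suc t) \<le> f t (x t, u t))}"

definition admissible_conv ::
  "(nat \<Rightarrow> 'x set) \<Rightarrow> (nat \<Rightarrow> 'u set) \<Rightarrow> (nat \<Rightarrow> 'x \<times> 'u \<Rightarrow> 'x::ord)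
    \<Rightarrow> (nat \<Rightarrow> 'x \<times> 'u \<Rightarrow> real) \<Rightarrow> 'x \<Rightarrow> ((nat \<Rightarrow> 'x) \<times> (nat \<Rightarrow> 'u)) set"
  where "admissible_conv X U f \<phi> \<sigma> =
    {(x, u) \<in> admissible X U f \<sigma>. summable (\<lambda>t. \<phi> t (x t, u t))}"

definition total_payoff ::
  "(nat \<Rightarrow> 'x \<times> 'u \<Rightarrow> real) \<Rightarrow> (nat \<Rightarrow> 'x) \<times> (nat \<Rightarrow> 'u) \<Rightarrow> real"
  where "total_payoff \<phi> = (\<lambda>(x, u). \<Sum>t. \<phi> t (x t, u t))"

definition payoff_gap ::
  "(nat \<Rightarrow> 'x \<times> 'u \<Rightarrow> real) \<Rightarrow> (nat \<Rightarrow> 'x) \<times> (nat \<Rightarrow> 'u) \<Rightarrow> (nat \<Rightarrow> 'x) \<times> (nat \<Rightarrow> 'u) \<Rightarrow> nat \<Rightarrow> real"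
  where "payoff_gap \<phi> = (\<lambda>(x', u') (x, u) T. \<Sum>t\<le>T. (\<phi> t (x' t, u' t) - \<phi> t (x t, u t)))"

definition solves_PI1 ::
  "(nat \<Rightarrow> 'x set) \<Rightarrow> (nat \<Rightarrow> 'u set) \<Rightarrow> (nat \<Rightarrow> 'x \<times> 'u \<Rightarrow> 'x::ord)
    \<Rightarrow> (nat \<Rightarrow> 'x \<times> 'u \<Rightarrow> real) \<Rightarrow> 'x \<Rightarrow> (nat \<Rightarrow> 'x) \<times> (nat \<Rightarrow> 'u) \<Rightarrow> bool"
  where "solves_PI1 X U f \<phi> \<sigma> z \<longleftrightarrow> z \<in> admissible_conv X U f \<phi> \<sigma> \<and>
    (\<forall>w\<in>admissible_conv X U f \<phi> \<sigma>. total_payoff \<phi> z \<ge> total_payoff \<phi> w)"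

text \<open>The upper and lower limits are taken in the extended reals, as they may be infinite.\<close>

definition solves_PI2 ::
  "(nat \<Rightarrow> 'x set) \<Rightarrow> (nat \<Rightarrow> 'u set) \<Rightarrow> (nat \<Rightarrow> 'x \<times> 'u \<Rightarrow> 'x::ord)
    \<Rightarrow> (nat \<Rightarrow> 'x \<times> 'u \<Rightarrow> real) \<Rightarrow> 'x \<Rightarrow> (nat \<Rightarrow> 'x) \<times> (nat \<Rightarrow> 'u) \<Rightarrow> bool"
  where "solves_PI2 X U f \<phi> \<sigma> z \<longleftrightarrow> z \<in> admissible X U f \<sigma> \<and>
    (\<forall>w\<in>admissible X U f \<sigma>. limsup (\<lambda>T. ereal (payoff_gap \<phi> z w T)) \<ge> 0)"

definition solves_PI3 ::
  "(nat \<Rightarrow> 'x set) \<Rightarrow> (nat \<Rightarrow> 'u set) \<Rightarrow> (nat \<Rightarrow> 'x \<times> 'u \<Rightarrow> 'x::ord)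
    \<Rightarrow> (nat \<Rightarrow> 'x \<times> 'u \<Rightarrow> real) \<Rightarrow> 'x \<Rightarrow> (nat \<Rightarrow> 'x) \<times> (nat \<Rightarrow> 'u) \<Rightarrow> bool"
  where "solves_PI3 X U f \<phi> \<sigma> z \<longleftrightarrow> z \<in> admissible X U f \<sigma> \<and>
    (\<forall>w\<in>admissible X U f \<sigma>. liminf (\<lambda>T. ereal (payoff_gap \<phi> z w T)) \<ge> 0)"

definition tangent_set :: "'a::real_normed_vector set \<Rightarrow> 'a \<Rightarrow> 'a set"
  where "tangent_set S a = closure {\<alpha> *\<^sub>R (v - a) | \<alpha> v. 0 \<le> \<alpha> \<and> v \<in> S}"

text \<open>
  The set \<open>S\<close> on which \<open>f\<close> lives need not be open, so a differential of \<open>f\<close> at \<open>z\<close> is one of a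
  function \<open>g\<close> that agrees with \<open>f\<close> on \<open>S\<close> near \<open>z\<close>. It may depend on \<open>g\<close>, hence \<open>g\<close> is an
  argument here. The values of \<open>g\<close> outside the neighbourhood \<open>N\<close> play no role.
\<close>

definition differentiable_via ::
  "('a::real_normed_vector \<Rightarrow> 'b::real_normed_vector) \<Rightarrow> 'a set \<Rightarrow> ('a \<Rightarrow> 'b) \<Rightarrow> 'a \<Rightarrow> bool"
  where "differentiable_via f S g z \<longleftrightarrow>
    (\<exists>N. open N \<and> z \<in> N \<and> (\<forall>w\<in>N \<inter> S. g w = f w) \<and> g differentiable (at z))"

definition cont_differentiable_via ::
  "('a::real_normed_vector \<Rightarrow> 'b::real_normed_vector) \<Rightarrow> 'a set \<Rightarrow> ('a \<Rightarrow> 'b) \<Rightarrow> 'a \<Rightarrow> bool"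
  where "cont_differentiable_via f S g z \<longleftrightarrow>
    (\<exists>N. open N \<and> z \<in> N \<and> (\<forall>w\<in>N \<inter> S. g w = f w) \<and>
      (\<exists>g' :: 'a \<Rightarrow> 'a \<Rightarrow>\<^sub>L 'b.
        (\<forall>w\<in>N. (g has_derivative blinfun_apply (g' w)) (at w)) \<and> isCont g' z))"

definition D1 ::
  "('a::real_normed_vector \<times> 'b \<Rightarrow> 'c::real_normed_vector) \<Rightarrow> 'a \<times> 'b \<Rightarrow> 'a \<Rightarrow> 'c"
  where "D1 g z = frechet_derivative (\<lambda>x. g (x, snd z)) (at (fst z))"

definition D2 ::
  "('a \<times> 'b::real_normed_vector \<Rightarrow> 'c::real_normed_vector) \<Rightarrow> 'a \<times> 'b \<Rightarrow> 'b \<Rightarrow> 'c"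
  where "D2 g z = frechet_derivative (\<lambda>u. g (fst z, u)) (at (snd z))"

text \<open>
  The quotient by the direction space of \<open>A\<close> is spanned by the classes of finitely many vectors;
  if \<open>A\<close> is a linear subspace, its direction space is \<open>A\<close> itself.
\<close>

definition finite_codim :: "'a::real_vector set \<Rightarrow> bool"
  where "finite_codim A \<longleftrightarrow> affine A \<and> A \<noteq> {} \<and>
    (\<exists>B. finite B \<and> (\<forall>x. \<exists>b\<in>span B. x - b \<in> {a - a' | a a'. a \<in> A \<and> a' \<in> A}))"

end

theory Submission
  imports Defs "HOL-Analysis.Finite_Function_Topology"
begin

text \<open>
  Since the positive cone has an interior point \<open>e\<close> and the control sets are convex, optimality on a
  finite horizon excludes a feasible direction that increases the payoff and satisfies the
  linearised constraints with slack \<open>e\<close>. Hahn-Banach separation on finite sequences then gives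
  multipliers \<open>l\<close> and \<open>p 1, \<dots>, p (T + 1)\<close>. By (A4), \<open>p (t + 1)\<close> is bounded in terms of \<open>p t\<close> and \<open>l\<close>,
  so they may be scaled such that \<open>l + p 1 e = 1\<close>. As \<open>p 1\<close> is positive, \<open>p 1 e\<close> controls its norm;
  hence all multipliers are bounded independently of \<open>T\<close>, and the scaling prevents them from
  vanishing in the limit \<open>T \<rightarrow> \<infinity>\<close>.
\<close>

section \<open>Hahn-Banach separation for convex cones\<close>

text \<open>Two elements of the union lie in a common member of the chain; this supplies the upper
  bounds for Zorn's lemma.\<close>

lemma convex_cone_Union_chain:
  assumes "subset.chain {S. convex_cone S} C" "C \<noteq> {}"
  shows "convex_cone (\<Union>C)"
proof -
  have cone: "convex_cone S" if "S \<in> C" for S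
    using assms that by (auto simp: subset.chain_def)
  have "x + y \<in> \<Union>C" if xy: "x \<in> \<Union>C" "y \<in> \<Union>C" for x y
  proof -
    obtain S S' where "S \<in> C" "x \<in> S" "S' \<in> C" "y \<in> S'"
      using xy by blast
    moreover have "S \<subseteq> S' \<or> S' \<subseteq> S"
      using assms \<open>S \<in> C\<close> \<open>S' \<in> C\<close> by (auto simp: subset_chain_def)
    ultimately show ?thesis
      using cone convex_cone_add by (meson UnionI subsetD)
  qed
  moreover have "c *\<^sub>R x \<in> \<Union>C" if "0 \<le> c" "x \<in> \<Union>C" for c x
    using that cone convex_cone_scaleR by blast
  moreover have "0 \<in> \<Union>C"
    using assms(2) cone convex_cone_contains_0 by blast
  ultimately show ?thesis
    by (auto simp: convex_cone_iff)
qed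

text \<open>Zorn's lemma gives a cone maximal among those avoiding \<open>e\<close>. If it missed
  both \<open>v\<close> and \<open>- v\<close>, adjoining either one would capture \<open>e\<close>,
  and eliminating \<open>v\<close> from the two representations would put a positive multiple of
  \<open>e\<close> into the cone.\<close>

lemma maximal_convex_cone:
  assumes P: "convex_cone P" and e: "e \<notin> P"
  obtains Q where "convex_cone Q" "P \<subseteq> Q" "e \<notin> Q" "\<And>v. v \<in> Q \<or> - v \<in> Q"
proof -
  define \<Q> where "\<Q> = {Q. convex_cone Q \<and> P \<subseteq> Q \<and> e \<notin> Q}"
  have "\<exists>M\<in>\<Q>. \<forall>X\<in>\<Q>. M \<subseteq> X \<longrightarrow> X = M"
  proof (rule subset_Zorn_nonempty)
    show "\<Q> \<noteq> {}"
      using assms by (auto simp: \<Q>_def)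
    fix C assume C: "C \<noteq> {}" "subset.chain \<Q> C"
    then have "subset.chain {S. convex_cone S} C"
      by (auto simp: subset_chain_def \<Q>_def)
    then have "convex_cone (\<Union>C)"
      using C convex_cone_Union_chain by blast
    then show "\<Union>C \<in> \<Q>"
      using C by (auto simp: subset_chain_def \<Q>_def)
  qed
  then obtain Q where Q: "convex_cone Q" "P \<subseteq> Q" "e \<notin> Q"
    and max: "\<And>X. convex_cone X \<Longrightarrow> Q \<subseteq> X \<Longrightarrow> e \<notin> X \<Longrightarrow> X = Q"
    unfolding \<Q>_def by (smt (verit) mem_Collect_eq order_trans)
  have ext: "\<exists>a\<in>Q. \<exists>r>0. e = a + r *\<^sub>R v" if v: "v \<notin> Q" for v
  proof -
    \<comment> \<open>\<open>X\<close> is the cone generated by \<open>Q\<close> and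
      \<open>v\<close>. It is larger than \<open>Q\<close>, so maximality forces \<open>e\<close>
      into it.\<close>
    define X where "X = {a + r *\<^sub>R v | a r. a \<in> Q \<and> 0 \<le> r}"
    have "convex_cone X"
      unfolding convex_cone_iff
    proof (intro conjI ballI allI impI)
      show "0 \<in> X"
        unfolding X_def using convex_cone_contains_0[OF Q(1)] by force
    next
      fix x y assume "x \<in> X" "y \<in> X"
      then obtain a r b q where "x = a + r *\<^sub>R v" "y = b + q *\<^sub>R v" "a \<in> Q" "b \<in> Q" "0 \<le> r" "0 \<le> q"
        by (auto simp: X_def)
      then have "x + y = (a + b) + (r + q) *\<^sub>R v" "a + b \<in> Q" "0 \<le> r + q"
        using convex_cone_add[OF Q(1)] by (auto simp: algebra_simps)
      then show "x + y \<in> X"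
        unfolding X_def by blast
    next
      fix x c assume "x \<in> X" and c: "0 \<le> (c::real)"
      then obtain a r where "x = a + r *\<^sub>R v" "a \<in> Q" "0 \<le> r"
        by (auto simp: X_def)
      then have "c *\<^sub>R x = c *\<^sub>R a + (c * r) *\<^sub>R v" "c *\<^sub>R a \<in> Q" "0 \<le> c * r"
        using c convex_cone_scaleR[OF Q(1)] by (auto simp: algebra_simps)
      then show "c *\<^sub>R x \<in> X"
        unfolding X_def by blast
    qed
    moreover have "Q \<subseteq> X"
    proof
      fix a assume "a \<in> Q"
      then have "a = a + 0 *\<^sub>R v \<and> a \<in> Q \<and> 0 \<le> (0::real)" by simp
      then show "a \<in> X" unfolding X_def by blast
    qed
    moreover have "v \<in> X"
    proof -
      have "v = 0 + 1 *\<^sub>R v \<and> 0 \<in> Q \<and> 0 \<le> (1::real)"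
        using convex_cone_contains_0[OF Q(1)] by simp
      then show ?thesis unfolding X_def by blast
    qed
    ultimately have "e \<in> X"
      using max v by blast
    then obtain a r where "e = a + r *\<^sub>R v" "a \<in> Q" "0 \<le> r"
      by (auto simp: X_def)
    moreover from this have "r \<noteq> 0"
      using Q(3) by auto
    ultimately show ?thesis
      by (metis less_eq_real_def)
  qed
  have "v \<in> Q \<or> - v \<in> Q" for v
  proof (rule ccontr)
    assume "\<not> ?thesis"
    then obtain a r b q where *: "a \<in> Q" "0 < r" "e = a + r *\<^sub>R v"
      "b \<in> Q" "0 < q" "e = b + q *\<^sub>R (- v)"
      using ext[of v] ext[of "- v"] by blast
    have "(q + r) *\<^sub>R e = q *\<^sub>R (a + r *\<^sub>R v) + r *\<^sub>R (b + q *\<^sub>R (- v))"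
      by (metis *(3,6) scaleR_left.add)
    also have "\<dots> = q *\<^sub>R a + r *\<^sub>R b"
      by (simp add: algebra_simps)
    also have "\<dots> \<in> Q"
      using * Q(1) by (simp add: convex_cone_add convex_cone_scaleR)
    finally have "(q + r) *\<^sub>R e \<in> Q" .
    moreover have "0 < q + r"
      using *(2,5) by simp
    ultimately show False
      using Q(3) convex_cone_scaleR[OF Q(1), of "1 / (q + r)" "(q + r) *\<^sub>R e"] by simp
  qed
  with Q that show thesis by blast
qed

text \<open>The functional is read off a maximal convex cone, which is a half space, that contains
  \<open>P\<close> but not \<open>- e\<close>.\<close>

theorem Hahn_Banach_convex_cone:
  assumes P: "convex_cone P" and e: "e \<in> P" "- e \<notin> P"
    and unit: "\<And>v. \<exists>c. c *\<^sub>R e - v \<in> P"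
  obtains l where "linear l" "\<And>v. v \<in> P \<Longrightarrow> 0 \<le> l v" "l e = (1::real)"
proof -
  obtain Q where Q: "convex_cone Q" "P \<subseteq> Q" "- e \<notin> Q" and tot: "\<And>v. v \<in> Q \<or> - v \<in> Q"
    using maximal_convex_cone[OF P e(2)] by blast
  note add = convex_cone_add[OF Q(1)] and scale = convex_cone_scaleR[OF Q(1)]
  have neg: "0 \<le> c" if "c *\<^sub>R e \<in> Q" for c
  proof (rule ccontr)
    assume "\<not> 0 \<le> c"
    then show False
      using Q(3) scale[of "1 / - c" "c *\<^sub>R e"] that by simp
  qed
  \<comment> \<open>As \<open>Q\<close> is total, \<open>l v\<close> is the cut above which
    \<open>t *\<^sub>R e - v\<close> lies in \<open>Q\<close> and below which its negative does
    (\<open>up\<close>, \<open>down\<close>). By \<open>unique\<close> this determines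
    \<open>l v\<close>, so each identity for \<open>l\<close> reduces to memberships in
    \<open>Q\<close> on both sides of the cut.\<close>
  define l where "l v = Inf {t. t *\<^sub>R e - v \<in> Q}" for v
  have bdd: "- c \<le> t" if "c *\<^sub>R e - (- v) \<in> Q" "t *\<^sub>R e - v \<in> Q" for c t v
    using neg[of "c + t"] add[OF that] by (simp add: algebra_simps)
  have ne: "{t. t *\<^sub>R e - v \<in> Q} \<noteq> {}" for v
    using unit[of v] Q(2) by blast
  have bb: "bdd_below {t. t *\<^sub>R e - v \<in> Q}" for v
  proof -
    obtain c where "c *\<^sub>R e - (- v) \<in> Q"
      using unit[of "- v"] Q(2) by blast
    then show ?thesis
      using bdd by (intro bdd_belowI[of _ "- c"]) simp
  qed
  have up: "t *\<^sub>R e - v \<in> Q" if t: "l v < t" for t v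
  proof -
    obtain s where s: "s *\<^sub>R e - v \<in> Q" "s < t"
      using t cInf_lessD[OF ne[of v]] by (auto simp: l_def)
    then have "(t - s) *\<^sub>R e + (s *\<^sub>R e - v) \<in> Q"
      using Q(2) e by (intro add scale) auto
    then show ?thesis
      by (simp add: algebra_simps)
  qed
  have down: "v - t *\<^sub>R e \<in> Q" if t: "t < l v" for t v
    using tot[of "t *\<^sub>R e - v"] cInf_lower[OF _ bb[of v], of t] t by (force simp: l_def)
  have unique: "l v = r"
    if up': "\<And>t. r < t \<Longrightarrow> t *\<^sub>R e - v \<in> Q" and down': "\<And>t. t < r \<Longrightarrow> v - t *\<^sub>R e \<in> Q" for v r
  proof (rule ccontr)
    \<comment> \<open>Adding the two memberships puts \<open>(s - t) *\<^sub>R e\<close> into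
      \<open>Q\<close>, which excludes \<open>s < t\<close>. The points cutting the interval between
      \<open>l v\<close> and \<open>r\<close> into thirds would be such \<open>s\<close> and
      \<open>t\<close>.\<close>
    have contr: "\<not> s < t" if "s *\<^sub>R e - v \<in> Q" "v - t *\<^sub>R e \<in> Q" for s t
      using neg[of "s - t"] add[OF that] by (simp add: algebra_simps)
    assume "l v \<noteq> r"
    then consider "l v < r" | "r < l v"
      by linarith
    then show False
    proof cases
      case 1
      then show False
        using contr[of "(2 * l v + r) / 3" "(l v + 2 * r) / 3"] up[of v] down' by simp
    next
      case 2
      then show False
        using contr[of "(2 * r + l v) / 3" "(r + 2 * l v) / 3"] up' down[of _ v] by simp
    qed
  qed
  have l_add: "l (v + w) = l v + l w" for v w
  proof (rule unique)
    fix t assume t: "l v + l w < t"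
    \<comment> \<open>The excess of \<open>t\<close> over \<open>l v + l w\<close> is shared equally
      between \<open>a\<close> and \<open>b\<close>.\<close>
    obtain a b where ab: "t = a + b" "l v < a" "l w < b"
      using t by (intro that[of "(t + l v - l w) / 2" "(t + l w - l v) / 2"]) (auto simp: field_simps)
    then have "(a *\<^sub>R e - v) + (b *\<^sub>R e - w) \<in> Q"
      by (intro add up)
    then show "t *\<^sub>R e - (v + w) \<in> Q"
      by (simp add: ab(1) algebra_simps)
  next
    fix t assume t: "t < l v + l w"
    obtain a b where ab: "t = a + b" "a < l v" "b < l w"
      using t by (intro that[of "(t + l v - l w) / 2" "(t + l w - l v) / 2"]) (auto simp: field_simps)
    then have "(v - a *\<^sub>R e) + (w - b *\<^sub>R e) \<in> Q"
      by (intro add down)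
    then show "v + w - t *\<^sub>R e \<in> Q"
      by (simp add: ab(1) algebra_simps)
  qed
  have l0: "l 0 = 0"
    using l_add[of 0 0] by simp
  have l_neg: "l (- v) = - l v" for v
    using l_add[of v "- v"] l0 by simp
  have l_pos: "l (c *\<^sub>R v) = c * l v" if c: "0 < c" for c v
  proof (rule unique)
    fix t assume "c * l v < t"
    then have "c *\<^sub>R ((t / c) *\<^sub>R e - v) \<in> Q"
      using c by (intro scale up) (auto simp: field_simps)
    then show "t *\<^sub>R e - c *\<^sub>R v \<in> Q"
      using c by (simp add: scaleR_diff_right)
  next
    fix t assume "t < c * l v"
    then have "c *\<^sub>R (v - (t / c) *\<^sub>R e) \<in> Q"
      using c by (intro scale down) (auto simp: field_simps)
    then show "c *\<^sub>R v - t *\<^sub>R e \<in> Q"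
      using c by (simp add: scaleR_diff_right)
  qed
  have l_scale: "l (c *\<^sub>R v) = c * l v" for c v
    using l_pos[of c v] l_pos[of "- c" v] l0 l_neg
    by (cases c "0::real" rule: linorder_cases) auto
  have "linear l"
    by (rule linearI) (auto simp: l_add l_scale)
  moreover have "0 \<le> l v" if "v \<in> P" for v
  proof -
    have "l (- v) \<le> 0"
      unfolding l_def using that Q(2) by (intro cInf_lower bb[unfolded l_def]) auto
    then show ?thesis
      by (simp add: l_neg)
  qed
  moreover have "l e = 1"
  proof (rule unique)
    fix t :: real assume "1 < t"
    then have "(t - 1) *\<^sub>R e \<in> Q"
      using Q(2) e by (intro scale) auto
    then show "t *\<^sub>R e - e \<in> Q"
      by (simp add: algebra_simps)
  next
    fix t :: real assume "t < 1"
    then have "(1 - t) *\<^sub>R e \<in> Q"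
      using Q(2) e by (intro scale) auto
    then show "e - t *\<^sub>R e \<in> Q"
      by (simp add: algebra_simps)
  qed
  ultimately show thesis
    using that by blast
qed

section \<open>Multipliers on a finite horizon\<close>

lemma lookup_scaleR: "Poly_Mapping.lookup (c *\<^sub>R v) i = c *\<^sub>R Poly_Mapping.lookup v i"
proof -
  have "finite {i. c *\<^sub>R Poly_Mapping.lookup v i \<noteq> 0}"
    by (rule finite_subset[OF _ finite_lookup[of v]]) auto
  then show ?thesis
    by (simp add: scaleR_poly_mapping_def Abs_poly_mapping_inverse)
qed

lemma single_scaleR: "Poly_Mapping.single i (c *\<^sub>R x) = c *\<^sub>R Poly_Mapping.single i x"
  by (rule poly_mapping_eqI) (simp add: lookup_scaleR lookup_single when_def)

text \<open>\<open>P\<close> collects the perturbations of the payoff and of the constraints under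
  which the linearised problem has a direction with nonnegative gain. A functional that is
  nonnegative on this cone has the multipliers as its components, and evaluating it at perturbations
  that compensate a single \<open>h\<close> or \<open>k\<close> yields the adjoint equation and the
  maximum condition.\<close>

theorem finite_horizon_multipliers:
  fixes A :: "nat \<Rightarrow> 'x::ordered_real_vector \<times> 'u::real_vector \<Rightarrow> 'x"
    and b :: "nat \<Rightarrow> 'x \<times> 'u \<Rightarrow> real"
    and C :: "nat \<Rightarrow> 'u set"
    and e :: 'x
  assumes A: "\<And>t. linear (A t)" and b: "\<And>t. linear (b t)" and C: "\<And>t. convex_cone (C t)"
    and e: "0 \<le> e" and unit: "\<And>x. \<exists>c. x \<le> c *\<^sub>R e"
    and no_direction: "\<not> (\<exists>h k. h 0 = 0 \<and> h (Suc T) = 0 \<and> (\<forall>t. k t \<in> C t) \<and>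
      1 \<le> (\<Sum>t\<le>T. b t (h t, k t)) \<and> (\<forall>t\<le>T. h (Suc t) + e \<le> A t (h t, k t)))"
  obtains l :: real and p :: "nat \<Rightarrow> 'x \<Rightarrow> real" where
    "0 \<le> l" "\<And>t. linear (p t)" "\<And>t x. 0 \<le> x \<Longrightarrow> 0 \<le> p t x" "l + (\<Sum>t\<le>T. p (Suc t) e) = 1"
    "\<And>t h. 1 \<le> t \<Longrightarrow> t \<le> T \<Longrightarrow> p t h = p (Suc t) (A t (h, 0)) + l * b t (h, 0)"
    "\<And>t k. t \<le> T \<Longrightarrow> k \<in> C t \<Longrightarrow> p (Suc t) (A t (0, k)) + l * b t (0, k) \<le> 0"
proof -
  text \<open>Coordinate \<open>Suc t\<close> of \<open>v\<close> belongs to the constraint at time \<open>t\<close>.\<close>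
  define P where "P = {(a :: real, v :: nat \<Rightarrow>\<^sub>0 'x). \<exists>h k. h 0 = 0 \<and> h (Suc T) = 0 \<and> (\<forall>t. k t \<in> C t) \<and>
    0 \<le> a + (\<Sum>t\<le>T. b t (h t, k t)) \<and>
    (\<forall>t\<le>T. h (Suc t) \<le> Poly_Mapping.lookup v (Suc t) + A t (h t, k t))}"
  have PI: "(a, v) \<in> P" if "h 0 = 0" "h (Suc T) = 0" "\<And>t. k t \<in> C t"
    "0 \<le> a + (\<Sum>t\<le>T. b t (h t, k t))"
    "\<And>t. t \<le> T \<Longrightarrow> h (Suc t) \<le> Poly_Mapping.lookup v (Suc t) + A t (h t, k t)" for a v h k
    unfolding P_def using that by blast
  have C0: "0 \<in> C t" for t
    using C convex_cone_contains_0 by blast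
  have A0: "A t (0, 0) = 0" and b0: "b t (0, 0) = 0" for t
    using linear_0[OF A] linear_0[OF b] by (simp_all add: zero_prod_def)
  have A_add: "A t (x + x', k + k') = A t (x, k) + A t (x', k')"
    and b_add: "b t (x + x', k + k') = b t (x, k) + b t (x', k')" for t x x' k k'
    using linear_add[OF A[of t], of "(x, k)" "(x', k')"] linear_add[OF b[of t], of "(x, k)" "(x', k')"] by auto
  have A_scale: "A t (c *\<^sub>R x, c *\<^sub>R k) = c *\<^sub>R A t (x, k)"
    and b_scale: "b t (c *\<^sub>R x, c *\<^sub>R k) = c * b t (x, k)" for t x k c
    using linear_cmul[OF A[of t], of c "(x, k)"] linear_cmul[OF b[of t], of c "(x, k)"] by auto
  have nonneg_in_P: "(a, v) \<in> P" if "0 \<le> a" "\<And>t. 0 \<le> Poly_Mapping.lookup v t" for a v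
    using that by (intro PI[of "\<lambda>_. 0" "\<lambda>_. 0"]) (auto simp: A0 b0 C0)
  have P: "convex_cone P"
    unfolding convex_cone_iff
  proof (intro conjI ballI allI impI)
    show "0 \<in> P"
      unfolding zero_prod_def by (rule nonneg_in_P) auto
  next
    fix x y assume "x \<in> P" "y \<in> P"
    then obtain a v h k a' v' h' k' where
      x: "x = (a, v)" "h 0 = 0" "h (Suc T) = 0" "\<And>t. k t \<in> C t" "0 \<le> a + (\<Sum>t\<le>T. b t (h t, k t))"
        "\<And>t. t \<le> T \<Longrightarrow> h (Suc t) \<le> Poly_Mapping.lookup v (Suc t) + A t (h t, k t)" and
      y: "y = (a', v')" "h' 0 = 0" "h' (Suc T) = 0" "\<And>t. k' t \<in> C t" "0 \<le> a' + (\<Sum>t\<le>T. b t (h' t, k' t))"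
        "\<And>t. t \<le> T \<Longrightarrow> h' (Suc t) \<le> Poly_Mapping.lookup v' (Suc t) + A t (h' t, k' t)"
      unfolding P_def by blast
    have "(a + a', v + v') \<in> P"
    proof (rule PI[of "\<lambda>t. h t + h' t" "\<lambda>t. k t + k' t"])
      show "k t + k' t \<in> C t" for t
        using x(4) y(4) C convex_cone_add by blast
      show "0 \<le> a + a' + (\<Sum>t\<le>T. b t (h t + h' t, k t + k' t))"
        using x(5) y(5) by (simp add: b_add sum.distrib)
      show "h (Suc t) + h' (Suc t)
          \<le> Poly_Mapping.lookup (v + v') (Suc t) + A t (h t + h' t, k t + k' t)" if "t \<le> T" for t
        using add_mono[OF x(6) y(6), OF that that] by (simp add: A_add lookup_add algebra_simps)
    qed (use x y in auto)
    then show "x + y \<in> P"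
      using x y by simp
  next
    fix x and c :: real assume "x \<in> P" and c: "0 \<le> c"
    then obtain a v h k where
      x: "x = (a, v)" "h 0 = 0" "h (Suc T) = 0" "\<And>t. k t \<in> C t" "0 \<le> a + (\<Sum>t\<le>T. b t (h t, k t))"
        "\<And>t. t \<le> T \<Longrightarrow> h (Suc t) \<le> Poly_Mapping.lookup v (Suc t) + A t (h t, k t)"
      unfolding P_def by blast
    have "(c * a, c *\<^sub>R v) \<in> P"
    proof (rule PI[of "\<lambda>t. c *\<^sub>R h t" "\<lambda>t. c *\<^sub>R k t"])
      show "c *\<^sub>R k t \<in> C t" for t
        using x(4) c C convex_cone_scaleR by blast
      show "0 \<le> c * a + (\<Sum>t\<le>T. b t (c *\<^sub>R h t, c *\<^sub>R k t))"
        using mult_nonneg_nonneg[OF c x(5)] by (simp add: b_scale sum_distrib_left algebra_simps)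
      show "c *\<^sub>R h (Suc t) \<le> Poly_Mapping.lookup (c *\<^sub>R v) (Suc t) + A t (c *\<^sub>R h t, c *\<^sub>R k t)"
        if "t \<le> T" for t
        using scaleR_left_mono[OF x(6)[OF that] c] by (simp add: A_scale lookup_scaleR scaleR_add_right)
    qed (use x in auto)
    then show "c *\<^sub>R x \<in> P"
      using x by simp
  qed
  \<comment> \<open>Unit slack in the payoff and slack \<open>e\<close> in each of the constraints
    at times 0 to \<open>T\<close>; the value 1 of the functional at \<open>E\<close> becomes the
    normalisation of the multipliers.\<close>
  define E :: "real \<times> (nat \<Rightarrow>\<^sub>0 'x)" where "E = (1, \<Sum>t\<le>T. Poly_Mapping.single (Suc t) e)"
  have lookup_E: "Poly_Mapping.lookup (snd E) (Suc t) = e" if "t \<le> T" for t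
    using that by (simp add: E_def lookup_sum lookup_single when_def sum.delta)
  have lookup_E_nonneg: "0 \<le> Poly_Mapping.lookup (snd E) t" for t
    using e by (auto simp: E_def lookup_sum lookup_single when_def intro!: sum_nonneg)
  have E: "E = (1, snd E)"
    by (simp add: E_def)
  have "E \<in> P"
    using lookup_E_nonneg by (subst E) (intro nonneg_in_P, auto)
  \<comment> \<open>A direction witnessing this membership would have gain at least 1 and slack
    \<open>e\<close> in every constraint.\<close>
  moreover have "- E \<notin> P"
  proof
    assume "- E \<in> P"
    then have "(- 1, - snd E) \<in> P"
      by (metis E uminus_Pair)
    then obtain h k where h: "h 0 = 0" "h (Suc T) = 0" "\<And>t. k t \<in> C t"
      "0 \<le> - 1 + (\<Sum>t\<le>T. b t (h t, k t))"
      "\<And>t. t \<le> T \<Longrightarrow> h (Suc t) \<le> Poly_Mapping.lookup (- snd E) (Suc t) + A t (h t, k t)"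
      unfolding P_def by blast
    have "h (Suc t) + e \<le> A t (h t, k t)" if "t \<le> T" for t
      using h(5)[OF that] lookup_E[OF that] by (simp add: algebra_simps)
    moreover have "1 \<le> (\<Sum>t\<le>T. b t (h t, k t))"
      using h(4) by simp
    ultimately show False
      using no_direction h(1-3) by blast
  qed
  moreover have "\<exists>c. c *\<^sub>R E - v \<in> P" for v
  proof -
    define c where "c t = (SOME c. Poly_Mapping.lookup (snd v) (Suc t) \<le> c *\<^sub>R e)" for t
    have c: "Poly_Mapping.lookup (snd v) (Suc t) \<le> c t *\<^sub>R e" for t
      unfolding c_def by (rule someI_ex[OF unit])
    \<comment> \<open>Only the coordinates 1 to \<open>T + 1\<close> of \<open>v\<close> are
      constrained in \<open>P\<close>, so a single multiple of \<open>E\<close> dominates all that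
      matters.\<close>
    define m where "m = \<bar>fst v\<bar> + (\<Sum>t\<le>T. \<bar>c t\<bar>)"
    have "Poly_Mapping.lookup (snd v) (Suc t) \<le> m *\<^sub>R e" if "t \<le> T" for t
    proof -
      have "c t \<le> \<bar>c t\<bar>"
        by simp
      also have "\<bar>c t\<bar> \<le> (\<Sum>t\<le>T. \<bar>c t\<bar>)"
        using that by (intro member_le_sum) auto
      finally have "c t \<le> m"
        by (simp add: m_def)
      then show ?thesis
        using c e scaleR_right_mono order_trans by blast
    qed
    then have "(m - fst v, m *\<^sub>R snd E - snd v) \<in> P"
      by (intro PI[of "\<lambda>_. 0" "\<lambda>_. 0"])
        (auto simp: A0 b0 C0 m_def lookup_minus lookup_scaleR lookup_E add_increasing2 sum_nonneg)
    then have "m *\<^sub>R E - v \<in> P"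
      by (metis E diff_Pair mult.right_neutral prod.collapse real_scaleR_def scaleR_Pair)
    then show ?thesis ..
  qed
  ultimately obtain L where L: "linear L" and L_P: "\<And>v. v \<in> P \<Longrightarrow> 0 \<le> L v" and L_E: "L E = (1::real)"
    using Hahn_Banach_convex_cone[OF P] by blast
  define l where "l = L (1, 0)"
  define p where "p t x = L (0, Poly_Mapping.single t x)" for t x
  have L_eq: "L (a, v) = a * l + L (0, v)" for a v
    using linear_add[OF L, of "a *\<^sub>R (1, 0)" "(0, v)"] linear_cmul[OF L, of a "(1, 0)"] by (simp add: l_def)
  have L_diff: "L (0, v - w) = L (0, v) - L (0, w)" for v w
    using linear_diff[OF L, of "(0, v)" "(0, w)"] by simp
  have L_sum: "L (0, sum g S) = (\<Sum>i\<in>S. L (0, g i))" for g and S :: "nat set"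
    using linear_sum[OF L, of "\<lambda>i. (0, g i)" S] by (simp add: sum_prod)
  have "0 \<le> l"
    unfolding l_def by (intro L_P nonneg_in_P) auto
  moreover have p: "linear (p t)" for t
  proof (rule linearI)
    show "p t (x + y) = p t x + p t y" for x y
      using linear_add[OF L, of "(0, Poly_Mapping.single t x)" "(0, Poly_Mapping.single t y)"]
      by (simp add: p_def single_add)
    show "p t (c *\<^sub>R x) = c *\<^sub>R p t x" for c x
      using linear_cmul[OF L, of c "(0, Poly_Mapping.single t x)"]
      by (simp add: p_def single_scaleR)
  qed
  moreover have "0 \<le> p t x" if "0 \<le> x" for t x
    unfolding p_def using that by (intro L_P nonneg_in_P) (auto simp: lookup_single when_def)
  moreover have "l + (\<Sum>t\<le>T. p (Suc t) e) = 1"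
    using L_E L_eq[of 1 "snd E"] E by (simp add: E_def L_sum p_def)
  moreover have "p t h = p (Suc t) (A t (h, 0)) + l * b t (h, 0)" if t: "1 \<le> t" "t \<le> T" for t h
  proof -
    have le: "p (Suc t) (A t (x, 0)) + l * b t (x, 0) \<le> p t x" for x
    proof -
      \<comment> \<open>A state variation at time \<open>t\<close> alone enters the constraints at
        times \<open>t - 1\<close> and \<open>t\<close>. Its sign is free, so the inequality for
        \<open>h\<close> and \<open>- h\<close> gives an equation; a control variation is confined
        to a cone and gives only an inequality.\<close>
      have "(- b t (x, 0), Poly_Mapping.single t x - Poly_Mapping.single (Suc t) (A t (x, 0))) \<in> P"
      proof (rule PI[of "\<lambda>s. if s = t then x else 0" "\<lambda>_. 0"])
        have "(\<Sum>s\<le>T. b s (if s = t then x else 0, 0)) = (\<Sum>s\<le>T. if s = t then b s (x, 0) else 0)"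
          by (intro sum.cong) (auto simp: b0)
        then show "0 \<le> - b t (x, 0) + (\<Sum>s\<le>T. b s (if s = t then x else 0, 0))"
          using t by (simp add: sum.delta)
      qed (use t in \<open>auto simp: C0 A0 lookup_minus lookup_single when_def\<close>)
      from L_P[OF this] show ?thesis
        by (subst (asm) L_eq) (simp add: L_diff p_def mult.commute)
    qed
    have "A t (- h, 0) = - A t (h, 0)" "b t (- h, 0) = - b t (h, 0)"
      using linear_neg[OF A[of t], of "(h, 0)"] linear_neg[OF b[of t], of "(h, 0)"] by auto
    then show ?thesis
      using le[of h] le[of "- h"] by (simp add: linear_neg[OF p])
  qed
  moreover have "p (Suc t) (A t (0, k)) + l * b t (0, k) \<le> 0" if t: "t \<le> T" and k: "k \<in> C t" for t k
  proof -
    have "(- b t (0, k), - Poly_Mapping.single (Suc t) (A t (0, k))) \<in> P"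
    proof (rule PI[of "\<lambda>_. 0" "\<lambda>s. if s = t then k else 0"])
      have "(\<Sum>s\<le>T. b s (0, if s = t then k else 0)) = (\<Sum>s\<le>T. if s = t then b s (0, k) else 0)"
        by (intro sum.cong) (auto simp: b0)
      then show "0 \<le> - b t (0, k) + (\<Sum>s\<le>T. b s (0, if s = t then k else 0))"
        using t by (simp add: sum.delta)
    qed (use k in \<open>auto simp: C0 A0 lookup_single when_def\<close>)
    from L_P[OF this] show ?thesis
      using L_diff[of 0 "Poly_Mapping.single (Suc t) (A t (0, k))"] linear_0[OF L]
      by (subst (asm) L_eq) (simp add: p_def mult.commute zero_prod_def)
  qed
  ultimately show thesis
    using that by blast
qed

section \<open>Uniform bounds and the limit\<close>

text \<open>Moving from \<open>e\<close> by distance \<open>r\<close> in any direction stays in the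
  positive cone, so the value at \<open>e\<close> controls the norm of a positive
  functional.\<close>

lemma positive_linear_bound:
  fixes p :: "'x::{real_normed_vector, ordered_real_vector} \<Rightarrow> real"
  assumes p: "linear p" and pos: "\<And>x. 0 \<le> x \<Longrightarrow> 0 \<le> p x"
    and r: "0 < r" "cball e r \<subseteq> {x. 0 \<le> x}"
  shows "\<bar>p x\<bar> \<le> p e / r * norm x"
proof -
  have *: "- p x \<le> p e / r * norm x" for x
  proof (cases "x = 0")
    case True
    then show ?thesis
      using linear_0[OF p] by simp
  next
    case False
    then have "e + (r / norm x) *\<^sub>R x \<in> cball e r"
      using r by (simp add: dist_norm)
    then have "0 \<le> p (e + (r / norm x) *\<^sub>R x)"
      using pos r by blast
    then have "0 \<le> p e + r / norm x * p x"
      by (simp add: linear_add[OF p] linear_cmul[OF p])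
    then show ?thesis
      using r False by (simp add: field_simps)
  qed
  from *[of x] *[of "- x"] show ?thesis
    by (simp add: linear_neg[OF p])
qed

lemma linear_bound_on_ball:
  fixes q :: "'x::real_normed_vector \<Rightarrow> real"
  assumes q: "linear q" and r: "0 < r" and le: "\<And>y. norm y \<le> r \<Longrightarrow> q y \<le> c"
  shows "\<bar>q y\<bar> \<le> c / r * norm y"
proof -
  have *: "q y \<le> c / r * norm y" for y
  proof (cases "y = 0")
    case True
    then show ?thesis
      using linear_0[OF q] by simp
  next
    case False
    then have "q ((r / norm y) *\<^sub>R y) \<le> c"
      using r by (intro le) simp
    then have "r / norm y * q y \<le> c"
      by (simp add: linear_cmul[OF q])
    then show ?thesis
      using r False by (simp add: field_simps)
  qed
  from *[of y] *[of "- y"] show ?thesis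
    by (simp add: linear_neg[OF q])
qed

text \<open>This is where (A4) acts: a bound on one multiplier passes to the next. Each
  \<open>y\<close> in the ball is the image of some \<open>(h, k)\<close> of norm at most 1; the
  adjoint equation rewrites \<open>q (A (h, 0))\<close> through \<open>p h\<close>, and the maximum
  condition bounds \<open>q (A (0, k))\<close> from above.\<close>

lemma multiplier_step_bound:
  fixes A :: "'x::real_normed_vector \<times> 'u::real_normed_vector \<Rightarrow> 'y::real_normed_vector"
  assumes A: "bounded_linear A" and b: "bounded_linear b" and q: "bounded_linear q"
    and adj: "\<And>h. p h = q (A (h, 0)) + l * b (h, 0)"
    and max: "\<And>k. k \<in> C \<Longrightarrow> q (A (0, k)) + l * b (0, k) \<le> 0"
    and r: "0 < r" "cball 0 r \<subseteq> A ` ((UNIV \<times> closure C) \<inter> cball 0 1)"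
    and p: "\<And>h. \<bar>p h\<bar> \<le> c * norm h" "0 \<le> c"
    and l: "0 \<le> l" "l \<le> m"
  shows "\<bar>q y\<bar> \<le> (c + m * onorm b) / r * norm y"
proof (rule linear_bound_on_ball[OF _ r(1)])
  show "linear q"
    using q by (rule bounded_linear.linear)
  fix y :: 'y assume "norm y \<le> r"
  then obtain h k where hk: "y = A (h, k)" "k \<in> closure C" "norm (h, k) \<le> 1"
  proof -
    have "y \<in> A ` ((UNIV \<times> closure C) \<inter> cball 0 1)"
      using r(2) \<open>norm y \<le> r\<close> by (meson mem_cball_0 subsetD)
    then show ?thesis
      using that by force
  qed
  \<comment> \<open>By continuity the maximum condition extends from \<open>C\<close> to its
    closure, where the preimages provided by (A4) live.\<close>
  have "bounded_linear (\<lambda>k. (0 :: 'x, k :: 'u))"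
    by (intro bounded_linear_Pair bounded_linear_zero bounded_linear_ident)
  then have "continuous_on UNIV (\<lambda>k. q (A (0, k)) + l * b (0, k))"
    by (intro continuous_intros linear_continuous_on bounded_linear_compose[OF q]
        bounded_linear_compose[OF A] bounded_linear_compose[OF b])
  then have "closed {k. q (A (0, k)) + l * b (0, k) \<le> 0}"
    by (intro closed_Collect_le) auto
  then have max': "q (A (0, k)) + l * b (0, k) \<le> 0"
    using hk(2) max closure_minimal[of C "{k. q (A (0, k)) + l * b (0, k) \<le> 0}"] by blast
  have split: "A (h, k) = A (h, 0) + A (0, k)" "b (h, k) = b (h, 0) + b (0, k)"
    using linear_add[OF bounded_linear.linear[OF A], of "(h, 0)" "(0, k)"] linear_add[OF bounded_linear.linear[OF b], of "(h, 0)" "(0, k)"]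
    by simp_all
  have "p h \<le> c"
  proof -
    have "norm h \<le> 1"
      using hk(3) norm_fst_le[of h k] by linarith
    then have "c * norm h \<le> c"
      using p(2) by (rule mult_left_le)
    then show ?thesis
      using p(1)[of h] by linarith
  qed
  moreover have "- (l * b (h, k)) \<le> m * onorm b"
  proof -
    have "\<bar>b (h, k)\<bar> \<le> onorm b * norm (h, k)"
      using onorm[OF b, of "(h, k)"] by simp
    also have "\<dots> \<le> onorm b"
      using hk(3) onorm_pos_le[OF b] by (rule mult_left_le)
    finally have "l * \<bar>b (h, k)\<bar> \<le> m * onorm b"
      using l by (intro mult_mono) auto
    moreover have "- (l * b (h, k)) \<le> l * \<bar>b (h, k)\<bar>"
      using l(1) by (metis abs_ge_minus_self abs_mult abs_of_nonneg)
    ultimately show ?thesis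
      by linarith
  qed
  moreover have "q y = q (A (h, 0)) + q (A (0, k))"
    by (simp add: hk(1) split linear_add[OF bounded_linear.linear[OF q]])
  ultimately show "q y \<le> c + m * onorm b"
    using max' adj[of h] by (simp add: split algebra_simps)
qed

text \<open>With pairs of a time and a vector as indices, a whole sequence of functionals is one
  point of such a box.\<close>

lemma compact_box:
  fixes d :: "'i \<Rightarrow> real"
  shows "compact {g. \<forall>i. \<bar>g i\<bar> \<le> d i}"
proof -
  have "compactin (product_topology (\<lambda>_. euclidean) UNIV) (PiE UNIV (\<lambda>i. cball (0 :: real) (d i)))"
    using compact_cball by (auto simp: compactin_PiE)
  moreover have "PiE UNIV (\<lambda>i. cball 0 (d i)) = {g. \<forall>i. \<bar>g i\<bar> \<le> d i}"
    by (auto simp: PiE_UNIV_domain Pi_def)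
  ultimately show ?thesis
    by (simp add: euclidean_product_topology)
qed

text \<open>The conditions at the various horizons are closed and nested on a product of compact
  intervals, so Tychonoff's theorem takes the place of weak-star convergent subsequences.\<close>

theorem infinite_horizon_multipliers:
  fixes A :: "nat \<Rightarrow> 'x::{real_normed_vector, ordered_real_vector} \<times> 'u::real_normed_vector \<Rightarrow> 'x"
    and b :: "nat \<Rightarrow> 'x \<times> 'u \<Rightarrow> real"
    and C :: "nat \<Rightarrow> 'u set"
    and e :: 'x
  assumes A: "\<And>t. bounded_linear (A t)" and b: "\<And>t. bounded_linear (b t)"
    and C: "\<And>t. convex_cone (C t)"
    and e: "e \<in> interior {x. 0 \<le> x}"
    and open_image: "\<And>t. 1 \<le> t \<Longrightarrow> 0 \<in> interior (A t ` ((UNIV \<times> closure (C t)) \<inter> cball 0 1))"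
    and no_direction: "\<And>T. \<not> (\<exists>h k. h 0 = 0 \<and> h (Suc T) = 0 \<and> (\<forall>t. k t \<in> C t) \<and>
      1 \<le> (\<Sum>t\<le>T. b t (h t, k t)) \<and> (\<forall>t\<le>T. h (Suc t) + e \<le> A t (h t, k t)))"
  obtains l :: real and p :: "nat \<Rightarrow> 'x \<Rightarrow>\<^sub>L real" where
    "0 \<le> l" "\<And>t x. 0 \<le> x \<Longrightarrow> 0 \<le> p t x" "l + p 1 e = 1"
    "\<And>t h. 1 \<le> t \<Longrightarrow> p t h = p (Suc t) (A t (h, 0)) + l * b t (h, 0)"
    "\<And>t k. k \<in> C t \<Longrightarrow> p (Suc t) (A t (0, k)) + l * b t (0, k) \<le> 0"
proof -
  obtain r0 where r0: "0 < r0" "cball e r0 \<subseteq> {x. 0 \<le> x}"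
    using e by (meson mem_interior_cball)
  then have e0: "0 \<le> e"
    by (metis centre_in_cball less_imp_le mem_Collect_eq subsetD)
  \<comment> \<open>The ball around the interior point \<open>e\<close> makes \<open>e\<close> an
    order unit.\<close>
  have unit: "\<exists>c. x \<le> c *\<^sub>R e" for x :: 'x
  proof (cases "x = 0")
    case True
    then show ?thesis
      by (intro exI[of _ 0]) simp
  next
    case False
    then have "e - (r0 / norm x) *\<^sub>R x \<in> cball e r0"
      using r0 by (simp add: dist_norm)
    then have "0 \<le> e - (r0 / norm x) *\<^sub>R x"
      using r0 by blast
    then have "(norm x / r0) *\<^sub>R ((r0 / norm x) *\<^sub>R x) \<le> (norm x / r0) *\<^sub>R e"
      using r0 by (intro scaleR_left_mono) auto
    then show ?thesis
      using r0 False by auto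
  qed
  have "\<exists>r>0. cball 0 r \<subseteq> A t ` ((UNIV \<times> closure (C t)) \<inter> cball 0 1)" if "1 \<le> t" for t
    using open_image[OF that] by (meson mem_interior_cball)
  then obtain r where r: "\<And>t. 1 \<le> t \<Longrightarrow> 0 < r t"
    "\<And>t. 1 \<le> t \<Longrightarrow> cball 0 (r t) \<subseteq> A t ` ((UNIV \<times> closure (C t)) \<inter> cball 0 1)"
    by metis
  \<comment> \<open>\<open>d n\<close> bounds the norm of \<open>p (n + 1)\<close> in units of
    \<open>l + p 1 e\<close>: the start comes from \<open>positive_linear_bound\<close>, the
    recursion from \<open>multiplier_step_bound\<close>.\<close>
  define d where "d = rec_nat (1 / r0) (\<lambda>n dn. (dn + onorm (b (Suc n))) / r (Suc n))"
  have d0: "d 0 = 1 / r0" and d_Suc: "\<And>n. d (Suc n) = (d n + onorm (b (Suc n))) / r (Suc n)"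
    by (simp_all add: d_def)
  have d_nonneg: "0 \<le> d n" for n
    by (induction n) (use r0 r onorm_pos_le[OF b] in \<open>auto simp: d0 d_Suc intro!: divide_nonneg_pos\<close>)
  text \<open>\<open>g (n, _)\<close> stands for \<open>p (n + 1)\<close> and \<open>1 - g (0, e)\<close> for \<open>l\<close>.\<close>
  define M where "M N = {g :: nat \<times> 'x \<Rightarrow> real.
    (\<forall>n x y. g (n, x + y) = g (n, x) + g (n, y)) \<and> (\<forall>n c x. g (n, c *\<^sub>R x) = c * g (n, x)) \<and>
    g (0, e) \<le> 1 \<and> (\<forall>n x. 0 \<le> x \<longrightarrow> 0 \<le> g (n, x)) \<and>
    (\<forall>n h. n < N \<longrightarrow> g (n, h) = g (Suc n, A (Suc n) (h, 0)) + (1 - g (0, e)) * b (Suc n) (h, 0)) \<and>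
    (\<forall>n k. n \<le> N \<longrightarrow> k \<in> C n \<longrightarrow> g (n, A n (0, k)) + (1 - g (0, e)) * b n (0, k) \<le> 0)}" for N
  define S where "S = {g :: nat \<times> 'x \<Rightarrow> real. \<forall>i. \<bar>g i\<bar> \<le> d (fst i) * norm (snd i)}"
  have "S \<inter> (\<Inter>N\<in>UNIV. M N) \<noteq> {}"
  proof (rule compact_imp_fip_image)
    show "compact S"
      unfolding S_def by (rule compact_box)
    \<comment> \<open>Each single condition involves finitely many coordinates of \<open>g\<close>,
      hence is closed in the product topology.\<close>
    show "closed (M N)" for N
      unfolding M_def
      by (intro closed_Collect_conj closed_Collect_all closed_Collect_imp closed_Collect_eq
          closed_Collect_le open_Collect_const continuous_intros continuous_on_product_coordinates)
  next
    fix I :: "nat set" assume I: "finite I"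
    \<comment> \<open>The sets \<open>M N\<close> decrease, so the largest horizon in
      \<open>I\<close> suffices; for empty \<open>I\<close> any \<open>N\<close> would do.\<close>
    define N where "N = Max I"
    obtain l p where l: "0 \<le> l" and p: "\<And>t. linear (p t)" and pos: "\<And>t x. 0 \<le> x \<Longrightarrow> 0 \<le> p t x"
      and sum: "l + (\<Sum>t\<le>N. p (Suc t) e) = 1"
      and adj: "\<And>t h. 1 \<le> t \<Longrightarrow> t \<le> N \<Longrightarrow> p t h = p (Suc t) (A t (h, 0)) + l * b t (h, 0)"
      and max: "\<And>t k. t \<le> N \<Longrightarrow> k \<in> C t \<Longrightarrow> p (Suc t) (A t (0, k)) + l * b t (0, k) \<le> 0"
      using finite_horizon_multipliers[OF bounded_linear.linear[OF A] bounded_linear.linear[OF b] C e0 unit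
          no_direction[of N]] by blast
    define m where "m = l + p 1 e"
    have m: "0 \<le> m" "l \<le> m" "p 1 e \<le> m"
      using l pos[OF e0, of 1] by (simp_all add: m_def)
    have blin: "bounded_linear (p t)" for t
      using positive_linear_bound[OF p pos r0, of t]
      by (intro bounded_linear_intro[where K = "p t e / r0"])
        (auto simp: linear_add[OF p] linear_cmul[OF p] mult.commute)
    have bound: "n \<le> N \<Longrightarrow> \<bar>p (Suc n) x\<bar> \<le> m * d n * norm x" for n x
    proof (induction n arbitrary: x)
      case 0
      have "\<bar>p 1 x\<bar> \<le> p 1 e / r0 * norm x"
        by (rule positive_linear_bound[OF p pos r0])
      also have "\<dots> \<le> m / r0 * norm x"
        using m r0 by (intro mult_right_mono divide_right_mono) auto
      finally show ?case
        by (simp add: d0)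
    next
      case (Suc n)
      have "\<bar>p (Suc (Suc n)) x\<bar> \<le> (m * d n + m * onorm (b (Suc n))) / r (Suc n) * norm x"
      proof (rule multiplier_step_bound[OF A[of "Suc n"] b[of "Suc n"] blin])
        show "p (Suc n) h = p (Suc (Suc n)) (A (Suc n) (h, 0)) + l * b (Suc n) (h, 0)" for h
          using Suc by (intro adj) auto
        show "p (Suc (Suc n)) (A (Suc n) (0, k)) + l * b (Suc n) (0, k) \<le> 0" if "k \<in> C (Suc n)" for k
          using Suc that by (intro max) auto
        show "0 < r (Suc n)" "cball 0 (r (Suc n)) \<subseteq> A (Suc n) ` ((UNIV \<times> closure (C (Suc n))) \<inter> cball 0 1)"
          by (rule r, simp)+
        show "\<bar>p (Suc n) h\<bar> \<le> m * d n * norm h" for h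
          using Suc by simp
      qed (use m l d_nonneg in auto)
      then show ?case
        by (simp add: d_Suc algebra_simps)
    qed
    \<comment> \<open>All multipliers are bounded by multiples of \<open>m\<close>, so
      \<open>m = 0\<close> would annihilate them and contradict the finite-horizon
      normalisation.\<close>
    have "m \<noteq> 0"
    proof
      assume "m = 0"
      then have "(\<Sum>t\<le>N. p (Suc t) e) = 0"
        using bound by (intro sum.neutral) auto
      then show False
        using sum m l \<open>m = 0\<close> by simp
    qed
    then have m_pos: "0 < m"
      using m by simp
    \<comment> \<open>Rescaling by \<open>m\<close> makes the bounds independent of the horizon. The
      padding by 0 is harmless because the adjoint and maximum conditions in \<open>M N\<close>
      reach only up to index \<open>N\<close>.\<close>
    define g where "g = (\<lambda>(n, x). if n \<le> N then p (Suc n) x / m else 0)"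
    have l_eq: "1 - g (0, e) = l / m"
      using m_pos by (simp add: g_def m_def field_simps)
    have "\<bar>g (n, x)\<bar> \<le> d n * norm x" for n x
      using bound[of n x] m_pos d_nonneg[of n]
      by (auto simp: g_def abs_divide pos_divide_le_eq algebra_simps)
    then have "g \<in> S"
      by (simp add: S_def)
    moreover have "g \<in> M N"
    proof -
      have "g (0, e) \<le> 1"
        using l_eq l m_pos by (metis diff_ge_0_iff_ge divide_nonneg_pos)
      moreover have "g (n, h) = g (Suc n, A (Suc n) (h, 0)) + (1 - g (0, e)) * b (Suc n) (h, 0)"
        if "n < N" for n h
        using that adj[of "Suc n" h] m_pos by (simp add: l_eq) (simp add: g_def add_divide_distrib)
      moreover have "g (n, A n (0, k)) + (1 - g (0, e)) * b n (0, k) \<le> 0" if "n \<le> N" "k \<in> C n" for n k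
        using that divide_nonpos_pos[OF max[OF that] m_pos]
        by (simp add: l_eq) (simp add: g_def add_divide_distrib)
      moreover have "0 \<le> g (n, x)" if "0 \<le> x" for n x
        using pos[OF that] m_pos by (simp add: g_def)
      moreover have "g (n, x + y) = g (n, x) + g (n, y)" "g (n, c *\<^sub>R x) = c * g (n, x)" for n x y c
        by (simp_all add: g_def linear_add[OF p] linear_cmul[OF p] add_divide_distrib)
      ultimately show ?thesis
        unfolding M_def by blast
    qed
    moreover have "M N \<subseteq> M N'" if "N' \<in> I" for N'
    proof -
      have "N' \<le> N"
        using that I by (simp add: N_def)
      then show ?thesis
        unfolding M_def by (intro Collect_mono) (meson order_less_le_trans order_trans)
    qed
    ultimately show "S \<inter> (\<Inter>N\<in>I. M N) \<noteq> {}"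
      by blast
  qed
  then obtain g where "g \<in> S" and g: "\<And>N. g \<in> M N"
    by blast
  have g_lin: "g (n, x + y) = g (n, x) + g (n, y)" "g (n, c *\<^sub>R x) = c * g (n, x)"
    and g_le: "g (0, e) \<le> 1" and g_pos: "0 \<le> x \<Longrightarrow> 0 \<le> g (n, x)" for n x y c
    using g[of 0] by (simp_all add: M_def)
  have g_adj: "g (n, h) = g (Suc n, A (Suc n) (h, 0)) + (1 - g (0, e)) * b (Suc n) (h, 0)" for n h
    using g[of "Suc n"] unfolding M_def mem_Collect_eq by (metis lessI)
  have g_max: "g (n, A n (0, k)) + (1 - g (0, e)) * b n (0, k) \<le> 0" if "k \<in> C n" for n k
    using g[of n] that unfolding M_def mem_Collect_eq by (metis order_refl)
  have "bounded_linear (\<lambda>x. g (n, x))" for n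
    using \<open>g \<in> S\<close> by (intro bounded_linear_intro[where K = "d n"]) (auto simp: S_def g_lin mult.commute)
  then have p: "blinfun_apply (Blinfun (\<lambda>x. g (n, x))) = (\<lambda>x. g (n, x))" for n
    by (rule bounded_linear_Blinfun_apply)
  show thesis
  \<comment> \<open>Truncated subtraction makes \<open>p 0\<close> a copy of \<open>p 1\<close>; the
    adjoint equation is claimed only from time 1 on.\<close>
  proof (rule that[of "1 - g (0, e)" "\<lambda>t. Blinfun (\<lambda>x. g (t - 1, x))"])
    fix t :: nat and h :: 'x assume "1 \<le> t"
    then show "Blinfun (\<lambda>x. g (t - 1, x)) h =
        Blinfun (\<lambda>x. g (Suc t - 1, x)) (A t (h, 0)) + (1 - g (0, e)) * b t (h, 0)"
      using g_adj[of "t - 1" h] by (simp add: p)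
  qed (use g_le g_pos g_max in \<open>auto simp: p\<close>)
qed

section \<open>Feasible directions at an optimal process\<close>

lemma has_derivative_directional:
  assumes "(g has_derivative g') (at z)"
  shows "((\<lambda>s. (g (z + s *\<^sub>R w) - g z) /\<^sub>R s) \<longlongrightarrow> g' w) (at_right 0)"
proof -
  have lin: "g' (s *\<^sub>R w) = s *\<^sub>R g' w" for s
    using assms by (simp add: has_derivative_linear linear_cmul)
  have "((\<lambda>s. g (z + s *\<^sub>R w)) has_derivative (\<lambda>s. g' (s *\<^sub>R w))) (at_right 0)"
    by (rule has_derivative_compose[where g = g])
      (use assms in \<open>auto intro!: derivative_eq_intros\<close>)
  then have "((\<lambda>s. (1 / \<bar>s\<bar>) *\<^sub>R (g (z + s *\<^sub>R w) - (g z + s *\<^sub>R g' w)) + g' w) \<longlongrightarrow> 0 + g' w) (at_right 0)"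
    by (intro tendsto_add tendsto_const) (simp add: has_derivative_within lin)
  moreover have "\<forall>\<^sub>F s in at_right 0. (1 / \<bar>s\<bar>) *\<^sub>R (g (z + s *\<^sub>R w) - (g z + s *\<^sub>R g' w)) + g' w
      = (g (z + s *\<^sub>R w) - g z) /\<^sub>R s"
    using eventually_at_right_less[of "0 :: real"]
    by eventually_elim (simp add: scaleR_diff_right scaleR_add_right inverse_eq_divide)
  ultimately show ?thesis
    by (simp add: tendsto_cong)
qed

lemma convex_cone_feasible_directions:
  assumes "convex S" "a \<in> S"
  shows "convex_cone {\<alpha> *\<^sub>R (v - a) | \<alpha> v. 0 \<le> \<alpha> \<and> v \<in> S}" (is "convex_cone ?C")
  unfolding convex_cone_iff
proof (intro conjI ballI allI impI)
  have "0 = 0 *\<^sub>R (a - a) \<and> 0 \<le> (0 :: real) \<and> a \<in> S"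
    using assms(2) by simp
  then show "0 \<in> ?C"
    by blast
next
  fix x y assume xy: "x \<in> ?C" "y \<in> ?C"
  then obtain \<alpha> v \<beta> w where x: "x = \<alpha> *\<^sub>R (v - a)" "0 \<le> \<alpha>" "v \<in> S" and y: "y = \<beta> *\<^sub>R (w - a)" "0 \<le> \<beta>" "w \<in> S"
    by blast
  show "x + y \<in> ?C"
  proof (cases "\<alpha> + \<beta> = 0")
    case True
    then have "\<alpha> = 0"
      using x(2) y(2) by auto
    then show ?thesis
      using xy(2) by (simp add: x(1))
  next
    case False
    \<comment> \<open>The sum of two feasible directions points to a weighted mean of their targets,
      which lies in \<open>S\<close> by convexity.\<close>
    define v' where "v' = (\<alpha> / (\<alpha> + \<beta>)) *\<^sub>R v + (\<beta> / (\<alpha> + \<beta>)) *\<^sub>R w"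
    have "v' \<in> S"
      unfolding v'_def using False x y by (intro convexD[OF assms(1)]) (auto simp: add_divide_distrib[symmetric])
    moreover have "(\<alpha> + \<beta>) *\<^sub>R v' = \<alpha> *\<^sub>R v + \<beta> *\<^sub>R w"
      using False by (simp add: v'_def scaleR_add_right)
    then have "x + y = (\<alpha> + \<beta>) *\<^sub>R (v' - a)"
      by (simp add: x(1) y(1) algebra_simps)
    ultimately show ?thesis
      using x(2) y(2) by force
  qed
next
  fix x and c :: real assume "x \<in> ?C" "0 \<le> c"
  then obtain \<alpha> v where "c *\<^sub>R x = (c * \<alpha>) *\<^sub>R (v - a)" "0 \<le> c * \<alpha>" "v \<in> S"
    by auto
  then show "c *\<^sub>R x \<in> ?C"
    by blast
qed

lemma eventually_feasible_direction:
  assumes "convex S" "a \<in> S" "k \<in> {\<alpha> *\<^sub>R (v - a) | \<alpha> v. 0 \<le> \<alpha> \<and> v \<in> S}"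
  shows "\<forall>\<^sub>F s :: real in at_right 0. a + s *\<^sub>R k \<in> S"
proof -
  obtain \<alpha> v where k: "k = \<alpha> *\<^sub>R (v - a)" "0 \<le> \<alpha>" "v \<in> S"
    using assms(3) by blast
  \<comment> \<open>The \<open>+ 1\<close> keeps the bound meaningful for
    \<open>\<alpha> = 0\<close> and still ensures \<open>s * \<alpha> \<le> 1\<close>.\<close>
  have "\<forall>\<^sub>F s :: real in at_right 0. s \<in> {0<..<1 / (\<alpha> + 1)}"
    using k(2) by (intro eventually_at_right_real) auto
  then show ?thesis
  proof eventually_elim
    case (elim s)
    then have "s * (\<alpha> + 1) < 1" "0 < s"
      using k(2) by (auto simp: field_simps)
    then have "0 \<le> s * \<alpha>" "s * \<alpha> \<le> 1"
      using k(2) by (auto simp: algebra_simps)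
    then have "(1 - s * \<alpha>) *\<^sub>R a + (s * \<alpha>) *\<^sub>R v \<in> S"
      using assms k(3) by (intro convexD) auto
    then show ?case
      by (simp add: k(1) algebra_simps)
  qed
qed

section \<open>Optimality against perturbations up to a finite time\<close>

text \<open>The three notions of optimality coincide against a competitor that returns to the
  optimal process: the payoff gap is constant from \<open>T\<close> on, so both of its limits equal
  that constant, and convergence of the optimal series carries over to the competitor.\<close>

lemma optimal_finite_horizon:
  assumes optimal: "solves_PI1 X U f \<phi> \<sigma> (xh, uh) \<or> solves_PI2 X U f \<phi> \<sigma> (xh, uh)
      \<or> solves_PI3 X U f \<phi> \<sigma> (xh, uh)"
    and xu: "(x, u) \<in> admissible X U f \<sigma>" and tail: "\<And>t. T < t \<Longrightarrow> x t = xh t \<and> u t = uh t"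
  shows "(\<Sum>t\<le>T. \<phi> t (x t, u t)) \<le> (\<Sum>t\<le>T. \<phi> t (xh t, uh t))"
proof -
  define \<delta> where "\<delta> t = \<phi> t (xh t, uh t) - \<phi> t (x t, u t)" for t
  have \<delta>_tail: "\<delta> t = 0" if "t \<notin> {..T}" for t
    using that tail by (simp add: \<delta>_def)
  have gap: "payoff_gap \<phi> (xh, uh) (x, u) T' = sum \<delta> {..T}" if "T \<le> T'" for T'
    unfolding payoff_gap_def prod.case \<delta>_def[symmetric]
    using that by (intro sum.mono_neutral_right) (auto simp: \<delta>_tail)
  have lim: "(\<lambda>T'. ereal (payoff_gap \<phi> (xh, uh) (x, u) T')) \<longlonglongrightarrow> ereal (sum \<delta> {..T})"
  proof (rule tendsto_eventually)
    show "\<forall>\<^sub>F T' in sequentially. ereal (payoff_gap \<phi> (xh, uh) (x, u) T') = ereal (sum \<delta> {..T})"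
      using eventually_ge_at_top[of T] by eventually_elim (simp add: gap)
  qed
  have "0 \<le> sum \<delta> {..T}"
    using optimal
  proof (elim disjE)
    assume "solves_PI1 X U f \<phi> \<sigma> (xh, uh)"
    then have S: "summable (\<lambda>t. \<phi> t (xh t, uh t))" and
      max: "\<And>w. w \<in> admissible_conv X U f \<phi> \<sigma> \<Longrightarrow> total_payoff \<phi> w \<le> total_payoff \<phi> (xh, uh)"
      by (auto simp: solves_PI1_def admissible_conv_def)
    have \<delta>: "\<delta> sums sum \<delta> {..T}"
      using \<delta>_tail by (intro sums_finite) auto
    have "(\<lambda>t. \<phi> t (x t, u t)) sums (suminf (\<lambda>t. \<phi> t (xh t, uh t)) - sum \<delta> {..T})"
      using sums_diff[OF summable_sums[OF S] \<delta>] by (simp add: \<delta>_def)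
    then have "total_payoff \<phi> (x, u) = total_payoff \<phi> (xh, uh) - sum \<delta> {..T}"
      "(x, u) \<in> admissible_conv X U f \<phi> \<sigma>"
      using xu by (auto simp: total_payoff_def admissible_conv_def sums_iff)
    with max show ?thesis
      by fastforce
  next
    assume "solves_PI2 X U f \<phi> \<sigma> (xh, uh)"
    then have "0 \<le> limsup (\<lambda>T'. ereal (payoff_gap \<phi> (xh, uh) (x, u) T'))"
      using xu by (auto simp: solves_PI2_def)
    then show ?thesis
      using lim_imp_Limsup[OF _ lim] by simp
  next
    assume "solves_PI3 X U f \<phi> \<sigma> (xh, uh)"
    then have "0 \<le> liminf (\<lambda>T'. ereal (payoff_gap \<phi> (xh, uh) (x, u) T'))"
      using xu by (auto simp: solves_PI3_def)
    then show ?thesis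
      using lim_imp_Liminf[OF _ lim] by simp
  qed
  then show ?thesis
    by (simp add: \<delta>_def sum_subtractf)
qed

text \<open>The process is moved by a small multiple of \<open>(h, k)\<close> up to time
  \<open>T\<close>. The interior slack \<open>e\<close> absorbs the linearisation error, so the
  constraints survive, while the first-order gain makes the payoff exceed the optimal one.\<close>

lemma no_improving_direction:
  fixes X :: "nat \<Rightarrow> 'x::{real_normed_vector, ordered_real_vector} set"
    and U :: "nat \<Rightarrow> 'u::real_normed_vector set"
  assumes optimal: "solves_PI1 X U f \<phi> \<sigma> (xh, uh) \<or> solves_PI2 X U f \<phi> \<sigma> (xh, uh)
      \<or> solves_PI3 X U f \<phi> \<sigma> (xh, uh)"
    and X: "\<And>t. open (X t)" and U: "\<And>t. convex (U t)"
    and N: "\<And>t. open (N t)" "\<And>t. (xh t, uh t) \<in> N t" "\<And>t w. w \<in> N t \<inter> (X t \<times> U t) \<Longrightarrow> F t w = f t w"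
      "\<And>t. (F t has_derivative A t) (at (xh t, uh t))"
    and M: "\<And>t. open (M t)" "\<And>t. (xh t, uh t) \<in> M t" "\<And>t w. w \<in> M t \<inter> (X t \<times> U t) \<Longrightarrow> \<Phi> t w = \<phi> t w"
      "\<And>t. (\<Phi> t has_derivative b t) (at (xh t, uh t))"
    and e: "e \<in> interior {x. 0 \<le> x}"
    and h: "h 0 = 0" "h (Suc T) = 0"
    and k: "\<And>t. k t \<in> {\<alpha> *\<^sub>R (v - uh t) | \<alpha> v. 0 \<le> \<alpha> \<and> v \<in> U t}"
    and gain: "0 < (\<Sum>t\<le>T. b t (h t, k t))"
    and slack: "\<And>t. t \<le> T \<Longrightarrow> h (Suc t) + e \<le> A t (h t, k t)"
  shows False
proof -
  have adm: "(xh, uh) \<in> admissible X U f \<sigma>"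
    using optimal by (auto simp: solves_PI1_def solves_PI2_def solves_PI3_def admissible_conv_def)
  then have xh: "xh t \<in> X t" and uh: "uh t \<in> U t" and xh0: "xh 0 = \<sigma>"
    and xh_step: "xh (Suc t) \<le> f t (xh t, uh t)" for t
    by (auto simp: admissible_def)
  define x where "x s t = (if t \<le> T then xh t + s *\<^sub>R h t else xh t)" for s t
  define u where "u s t = (if t \<le> T then uh t + s *\<^sub>R k t else uh t)" for s t
  have z: "(x s t, u s t) = (xh t, uh t) + s *\<^sub>R (h t, k t)" if "t \<le> T" for s t
    using that by (simp add: x_def u_def)
  have path: "((\<lambda>s. (x s t, u s t)) \<longlongrightarrow> (xh t, uh t)) (at_right 0)" if "t \<le> T" for t
    unfolding z[OF that] by (auto intro!: tendsto_eq_intros)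
  have in_X: "\<forall>\<^sub>F s in at_right 0. x s t \<in> X t" if "t \<le> T" for t
    using topological_tendstoD[OF tendsto_fst[OF path[OF that]] X[of t]] xh by simp
  have in_U: "\<forall>\<^sub>F s in at_right 0. u s t \<in> U t" if "t \<le> T" for t
    using eventually_feasible_direction[OF U uh k, of t] that by (simp add: u_def)
  have step: "\<forall>\<^sub>F s in at_right 0. x s (Suc t) \<le> f t (x s t, u s t)" if t: "t \<le> T" for t
  proof -
    \<comment> \<open>The difference quotient tends to \<open>A t (h t, k t)\<close>, so the
      expression below tends to \<open>e\<close> and eventually lies in the positive cone; with
      \<open>slack\<close> this gives \<open>h (Suc t) \<le> R s\<close>.\<close>
    define R where "R s = (F t ((xh t, uh t) + s *\<^sub>R (h t, k t)) - F t (xh t, uh t)) /\<^sub>R s" for s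
    have "((\<lambda>s. e + (R s - A t (h t, k t))) \<longlongrightarrow> e + (A t (h t, k t) - A t (h t, k t))) (at_right 0)"
      unfolding R_def by (intro tendsto_intros has_derivative_directional N)
    then have "\<forall>\<^sub>F s in at_right 0. e + (R s - A t (h t, k t)) \<in> interior {x. 0 \<le> x}"
      using e by (intro topological_tendstoD) auto
    with topological_tendstoD[OF path[OF t] N(1)[of t] N(2)[of t]] in_X[OF t] in_U[OF t]
      eventually_at_right_less[of "0 :: real"]
    show ?thesis
    proof eventually_elim
      case (elim s)
      have "0 \<le> e + (R s - A t (h t, k t))"
        using elim(5) interior_subset by blast
      from add_mono[OF slack[OF t] this] have "h (Suc t) \<le> R s"
        by (simp add: algebra_simps)
      then have "s *\<^sub>R h (Suc t) \<le> F t (x s t, u s t) - F t (xh t, uh t)"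
        using scaleR_left_mono[of "h (Suc t)" "R s" s] elim(4) by (simp add: R_def z[OF t])
      moreover have "F t (x s t, u s t) = f t (x s t, u s t)" "F t (xh t, uh t) = f t (xh t, uh t)"
        using elim xh uh N by auto
      ultimately have "xh (Suc t) + s *\<^sub>R h (Suc t) \<le> f t (x s t, u s t)"
        using add_mono[OF xh_step[of t]] by fastforce
      \<comment> \<open>At \<open>t = T\<close> the perturbed path is already back on
        \<open>xh\<close>, in agreement with \<open>h (Suc T) = 0\<close>.\<close>
      moreover have "x s (Suc t) = xh (Suc t) + s *\<^sub>R h (Suc t)"
        using t h(2) by (cases "t = T") (auto simp: x_def)
      ultimately show ?case
        by simp
    qed
  qed
  have "((\<lambda>s. \<Sum>t\<le>T. (\<Phi> t ((xh t, uh t) + s *\<^sub>R (h t, k t)) - \<Phi> t (xh t, uh t)) /\<^sub>R s)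
      \<longlongrightarrow> (\<Sum>t\<le>T. b t (h t, k t))) (at_right 0)"
    by (intro tendsto_sum has_derivative_directional M)
  then have "\<forall>\<^sub>F s in at_right 0. 0 < (\<Sum>t\<le>T. (\<Phi> t ((xh t, uh t) + s *\<^sub>R (h t, k t)) - \<Phi> t (xh t, uh t)) /\<^sub>R s)"
    using gain by (rule order_tendstoD)
  moreover have "\<forall>\<^sub>F s in at_right 0. \<forall>t\<in>{..T}. x s t \<in> X t \<and> u s t \<in> U t \<and> (x s t, u s t) \<in> M t
      \<and> x s (Suc t) \<le> f t (x s t, u s t)"
    by (intro eventually_ball_finite ballI eventually_conj in_X in_U step topological_tendstoD[OF path] M) auto
  ultimately have "\<forall>\<^sub>F s :: real in at_right 0. False"
    using eventually_at_right_less[of "0 :: real"]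
  proof eventually_elim
    case (elim s)
    have "x s t \<in> X t" "u s t \<in> U t" for t
      using elim(2) xh uh by (auto simp: x_def u_def)
    moreover have "x s (Suc t) \<le> f t (x s t, u s t)" for t
      using elim(2) xh_step[of t] by (cases "t \<le> T") (auto simp: x_def u_def)
    moreover have "x s 0 = \<sigma>"
      by (simp add: x_def h(1) xh0)
    ultimately have "(\<Sum>t\<le>T. \<phi> t (x s t, u s t)) \<le> (\<Sum>t\<le>T. \<phi> t (xh t, uh t))"
      by (intro optimal_finite_horizon[OF optimal]) (auto simp: admissible_def x_def u_def)
    moreover have "\<Phi> t ((xh t, uh t) + s *\<^sub>R (h t, k t)) = \<phi> t (x s t, u s t)"
      "\<Phi> t (xh t, uh t) = \<phi> t (xh t, uh t)" if "t \<le> T" for t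
      using that elim(2) xh uh M(2) M(3)[of _ t] unfolding z[OF that, symmetric] by blast+
    then have "0 < (\<Sum>t\<le>T. (\<phi> t (x s t, u s t) - \<phi> t (xh t, uh t)) /\<^sub>R s)"
      using elim(1) by simp
    then have "0 < ((\<Sum>t\<le>T. \<phi> t (x s t, u s t)) - (\<Sum>t\<le>T. \<phi> t (xh t, uh t))) / s"
      by (simp add: sum_subtractf[symmetric] sum_divide_distrib inverse_eq_divide)
    ultimately show False
      using elim(3) by (simp add: zero_less_divide_iff)
  qed
  then show False
    by simp
qed

section \<open>Partial differentials and the maximum principle\<close>

lemma frechet_derivative_partial:
  assumes "g differentiable (at z)"
  shows "D1 g z h = frechet_derivative g (at z) (h, 0)" "D2 g z k = frechet_derivative g (at z) (0, k)"
proof -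
  have g: "(g has_derivative frechet_derivative g (at z)) (at (fst z, snd z))"
    using assms by (simp add: frechet_derivative_works)
  have "((\<lambda>x. g (x, snd z)) has_derivative (\<lambda>h. frechet_derivative g (at z) (h, 0))) (at (fst z))"
    by (rule has_derivative_compose[where f = "\<lambda>x. (x, snd z)" and g = g, OF _ g]) (auto intro!: derivative_eq_intros)
  then show "D1 g z h = frechet_derivative g (at z) (h, 0)"
    unfolding D1_def by (metis frechet_derivative_at)
  have "((\<lambda>u. g (fst z, u)) has_derivative (\<lambda>k. frechet_derivative g (at z) (0, k))) (at (snd z))"
    by (rule has_derivative_compose[where f = "\<lambda>u. (fst z, u)" and g = g, OF _ g]) (auto intro!: derivative_eq_intros)
  then show "D2 g z k = frechet_derivative g (at z) (0, k)"
    unfolding D2_def by (metis frechet_derivative_at)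
qed

theorem theorem2p3:
  fixes X :: "nat \<Rightarrow> 'x::{banach, ordered_real_vector} set"
    and U :: "nat \<Rightarrow> 'u::banach set"
    and f F :: "nat \<Rightarrow> 'x \<times> 'u \<Rightarrow> 'x"
    and \<phi> \<Phi> :: "nat \<Rightarrow> 'x \<times> 'u \<Rightarrow> real"
    and \<sigma> :: 'x
    and xh :: "nat \<Rightarrow> 'x"
    and uh :: "nat \<Rightarrow> 'u"
    and s :: nat
    and K :: "'x set"
  assumes cone_closed: "closed {x::'x. 0 \<le> x}"
    and f_maps: "\<And>t x u. x \<in> X t \<Longrightarrow> u \<in> U t \<Longrightarrow> f t (x, u) \<in> X (Suc t)"
    and \<sigma>: "\<sigma> \<in> X 0"
    and optimal: "solves_PI1 X U f \<phi> \<sigma> (xh, uh) \<or> solves_PI2 X U f \<phi> \<sigma> (xh, uh)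
      \<or> solves_PI3 X U f \<phi> \<sigma> (xh, uh)"
    and A1: "\<And>t. X t \<noteq> {} \<and> open (X t) \<and> U t \<noteq> {}"
    and A2: "separable_space (euclidean :: 'x topology)"
    and A3_\<phi>: "\<And>t. differentiable_via (\<phi> t) (X t \<times> U t) (\<Phi> t) (xh t, uh t)"
    and A3_f: "\<And>t. cont_differentiable_via (f t) (X t \<times> U t) (F t) (xh t, uh t)"
    and A4: "\<And>t. t \<ge> 1 \<Longrightarrow>
      0 \<in> interior (frechet_derivative (F t) (at (xh t, uh t)) `
            ((UNIV \<times> tangent_set (U t) (uh t)) \<inter> cball 0 1))"
    and A5: "\<And>t. closed (range (D2 (F t) (xh t, uh t))) \<and>
      finite_codim (range (D2 (F t) (xh t, uh t)))"
    and A6: "K \<subseteq> D2 (F s) (xh s, uh s) ` tangent_set (U s) (uh s)"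
      "closed K" "convex K" "rel_interior K \<noteq> {}" "finite_codim (closure (affine hull K))"
    and U_convex: "\<And>t. convex (U t)"
    and cone_interior: "interior {x::'x. 0 \<le> x} \<noteq> {}"
  shows "\<exists>(l0::real) (p :: nat \<Rightarrow> 'x \<Rightarrow>\<^sub>L real).
      (\<forall>t\<ge>1. s \<le> t \<longrightarrow> (l0, p t) \<noteq> (0, 0)) \<and>
      0 \<le> l0 \<and> (\<forall>n\<ge>1. \<forall>x\<ge>0. 0 \<le> blinfun_apply (p n) x) \<and>
      (\<forall>t\<ge>1. \<forall>h. blinfun_apply (p t) h =
        blinfun_apply (p (Suc t)) (D1 (F t) (xh t, uh t) h) + l0 * D1 (\<Phi> t) (xh t, uh t) h) \<and>
      (\<forall>t. \<forall>u\<in>U t.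
        l0 * D2 (\<Phi> t) (xh t, uh t) (u - uh t) + blinfun_apply (p (Suc t)) (D2 (F t) (xh t, uh t) (u - uh t)) \<le> 0)"
proof -
  define z where "z t = (xh t, uh t)" for t
  have adm: "(xh, uh) \<in> admissible X U f \<sigma>"
    using optimal by (auto simp: solves_PI1_def solves_PI2_def solves_PI3_def admissible_conv_def)
  then have uh: "uh t \<in> U t" for t
    by (auto simp: admissible_def)
  have "\<exists>N. open N \<and> z t \<in> N \<and> (\<forall>w\<in>N \<inter> X t \<times> U t. F t w = f t w) \<and> F t differentiable at (z t)" for t
    using A3_f[of t] unfolding cont_differentiable_via_def z_def differentiable_def by meson
  then obtain N where N: "\<And>t. open (N t)" "\<And>t. z t \<in> N t"
    "\<And>t w. w \<in> N t \<inter> X t \<times> U t \<Longrightarrow> F t w = f t w" and F: "\<And>t. F t differentiable at (z t)"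
    by metis
  obtain M where M: "\<And>t. open (M t)" "\<And>t. z t \<in> M t"
    "\<And>t w. w \<in> M t \<inter> X t \<times> U t \<Longrightarrow> \<Phi> t w = \<phi> t w" and \<Phi>: "\<And>t. \<Phi> t differentiable at (z t)"
    using A3_\<phi> unfolding differentiable_via_def z_def by metis
  define A where "A t = frechet_derivative (F t) (at (z t))" for t
  define b where "b t = frechet_derivative (\<Phi> t) (at (z t))" for t
  \<comment> \<open>Small steps along this cone stay in \<open>U t\<close>, which can fail on its
    closure. The closure is the tangent set and enters through (A4) in
    \<open>open_image\<close>.\<close>
  define C where "C t = {\<alpha> *\<^sub>R (v - uh t) | \<alpha> v. 0 \<le> \<alpha> \<and> v \<in> U t}" for t
  have A: "(F t has_derivative A t) (at (z t))" and b: "(\<Phi> t has_derivative b t) (at (z t))" for t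
    using F \<Phi> by (simp_all add: A_def b_def frechet_derivative_works)
  obtain e :: 'x where e: "e \<in> interior {x. 0 \<le> x}"
    using cone_interior by blast
  have no_dir: "\<not> (\<exists>h k. h 0 = 0 \<and> h (Suc T) = 0 \<and> (\<forall>t. k t \<in> C t) \<and>
      1 \<le> (\<Sum>t\<le>T. b t (h t, k t)) \<and> (\<forall>t\<le>T. h (Suc t) + e \<le> A t (h t, k t)))" for T
  proof
    assume "\<exists>h k. h 0 = 0 \<and> h (Suc T) = 0 \<and> (\<forall>t. k t \<in> C t) \<and>
      1 \<le> (\<Sum>t\<le>T. b t (h t, k t)) \<and> (\<forall>t\<le>T. h (Suc t) + e \<le> A t (h t, k t))"
    then obtain h k where hk: "h 0 = 0" "h (Suc T) = 0" "\<And>t. k t \<in> C t"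
      "1 \<le> (\<Sum>t\<le>T. b t (h t, k t))" "\<And>t. t \<le> T \<Longrightarrow> h (Suc t) + e \<le> A t (h t, k t)"
      by blast
    show False
    proof (rule no_improving_direction[of X U f \<phi> \<sigma> xh uh N F A M \<Phi> b e h T k, OF optimal _ _ N[unfolded z_def] A[unfolded z_def] M[unfolded z_def]
          b[unfolded z_def] e hk(1,2) hk(3)[unfolded C_def] _ hk(5)])
      show "0 < (\<Sum>t\<le>T. b t (h t, k t))"
        using hk(4) by linarith
    qed (use A1 U_convex in auto)
  qed
  have open_image: "0 \<in> interior (A t ` ((UNIV \<times> closure (C t)) \<inter> cball 0 1))" if "1 \<le> t" for t
    using A4[OF that] by (simp add: A_def C_def z_def tangent_set_def)
  have C: "convex_cone (C t)" for t
    unfolding C_def by (intro convex_cone_feasible_directions U_convex uh)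
  obtain l :: real and p :: "nat \<Rightarrow> 'x \<Rightarrow>\<^sub>L real" where
    l: "0 \<le> l" and pos: "\<And>t x. 0 \<le> x \<Longrightarrow> 0 \<le> p t x" and norm: "l + p 1 e = 1"
    and adj: "\<And>t h. 1 \<le> t \<Longrightarrow> p t h = p (Suc t) (A t (h, 0)) + l * b t (h, 0)"
    and max: "\<And>t k. k \<in> C t \<Longrightarrow> p (Suc t) (A t (0, k)) + l * b t (0, k) \<le> 0"
    by (rule infinite_horizon_multipliers[of A b C e, OF has_derivative_bounded_linear[OF A]
          has_derivative_bounded_linear[OF b] C e open_image no_dir]) (assumption, rule that)
  have "(l, p t) \<noteq> (0, 0)" if "1 \<le> t" for t
  proof
    assume "(l, p t) = (0, 0)"
    then have "l = 0" "p t = 0"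
      by auto
    \<comment> \<open>With \<open>l = 0\<close> the adjoint equation carries a vanishing multiplier
      back to time 1, against \<open>l + p 1 e = 1\<close>.\<close>
    from that \<open>p t = 0\<close> have "p 1 = 0"
    proof (induction t rule: dec_induct)
      case (step n)
      have "p n = 0"
        by (rule blinfun_eqI) (use adj[of n] step \<open>l = 0\<close> in simp)
      then show ?case
        using step by blast
    qed simp
    then show False
      using norm \<open>l = 0\<close> by simp
  qed
  moreover have "p t h = p (Suc t) (D1 (F t) (xh t, uh t) h) + l * D1 (\<Phi> t) (xh t, uh t) h" if "1 \<le> t" for t h
    using adj[OF that] frechet_derivative_partial(1)[OF F, of t] frechet_derivative_partial(1)[OF \<Phi>, of t]
    by (simp add: A_def b_def z_def)
  moreover have "l * D2 (\<Phi> t) (xh t, uh t) (u - uh t) + p (Suc t) (D2 (F t) (xh t, uh t) (u - uh t)) \<le> 0"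
    if "u \<in> U t" for t u
  proof -
    have "u - uh t \<in> C t"
      unfolding C_def using that by (auto intro!: exI[of _ 1])
    from max[OF this] show ?thesis
      using frechet_derivative_partial(2)[OF F, of t] frechet_derivative_partial(2)[OF \<Phi>, of t]
      by (simp add: A_def b_def z_def)
  qed
  ultimately show ?thesis
    using l pos by blast
qed

end
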